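(* Let $d\ge2$, let $P_1,\dots,P_{d+1}$ be finite sets, each in general position in $\mathbb{R}^d$, and let $0<r\le\min\{|P_i|:1\le i\le d+1\}$ be an integer. Write $\Pi_d(P_i,r)=\{(P_{i,j},\Delta_{i,j})\}_{j}$ and $\Sigma_d(P_i,r)=\{\Delta_{i,j}\}_j$. Then the partitions $\Pi_d(P_1,r),\dots,\Pi_d(P_{d+1},r)$ determine only $O(r^{d+1-1/d})$ crossed $(d+1)$-tuples $(\Delta_{1,j_1},\dots,\Delta_{d+1,j_{d+1}})\in\Sigma_d(P_1,r)\times\cdots\times\Sigma_d(P_{d+1},r)$; the implicit constant depends only on $d$.
   Context: General position: no $d+1$ points on a common hyperplane. A simplicial $r$-partition of an $n$-point set $P$ is a collection $\{(P_i,\Delta_i)\}_{i=1}^r$ with $P=\bigsqcup P_i$, each nonempty $P_i$ satisfying $\lceil n/r\rceil\le|P_i|<2\lceil n/r\rceil$, and each $\Delta_i$ a closed $d$-simplex containing $P_i$ in its interior. $\Pi_d(P,r)$ denotes a fixed such partition in which every hyperplane intersects at most $c(d)r^{1-1/d}$ of the $\Delta_i$ ($c(d)$ depending only on $d$; such partitions exist by Matoušek's theorem), with simplex vertices in general position; $\Sigma_d(P,r)$ is its set of simplices. A family of $d+1$ convex sets is crossed if it is not separated, where separated means that for every $2\le k\le d+1$ no $k$ members can all be intersected by a single $(k-2)$-dimensional affine flat. *)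

theory Defs
  imports "HOL-Analysis.Analysis"
begin

definition hyperplane :: "(real ^ 'n) set \<Rightarrow> bool" where
  "hyperplane H \<longleftrightarrow> (\<exists>a b. a \<noteq> 0 \<and> H = {x. a \<bullet> x = b})"

definition general_position :: "(real ^ 'n) set \<Rightarrow> bool" where
  "general_position P \<longleftrightarrow>
     \<not> (\<exists>S H. S \<subseteq> P \<and> card S = CARD('n) + 1 \<and> hyperplane H \<and> S \<subseteq> H)"

text \<open>
  A collection of \<open>r\<close> pairs (point set, simplex) is a function on the indices \<open>1, ..., r\<close>;
  some of the point sets may be empty.
\<close>

definition simplicial_partition ::
  "(real ^ 'n) set \<Rightarrow> nat \<Rightarrow> (nat \<Rightarrow> (real ^ 'n) set \<times> (real ^ 'n) set) \<Rightarrow> bool" where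
  "simplicial_partition P r \<Q> \<longleftrightarrow>
     P = (\<Union>j\<in>{1..r}. fst (\<Q> j)) \<and>
     disjoint_family_on (\<lambda>j. fst (\<Q> j)) {1..r} \<and>
     (\<forall>j\<in>{1..r}. fst (\<Q> j) \<noteq> {} \<longrightarrow>
        \<lceil>real (card P) / real r\<rceil> \<le> int (card (fst (\<Q> j))) \<and>
        int (card (fst (\<Q> j))) < 2 * \<lceil>real (card P) / real r\<rceil>) \<and>
     (\<forall>j\<in>{1..r}. int CARD('n) simplex snd (\<Q> j) \<and> fst (\<Q> j) \<subseteq> interior (snd (\<Q> j)))"

definition simplices_of ::
  "nat \<Rightarrow> (nat \<Rightarrow> (real ^ 'n) set \<times> (real ^ 'n) set) \<Rightarrow> (real ^ 'n) set set" where
  "simplices_of r \<Q> = (\<lambda>j. snd (\<Q> j)) ` {1..r}"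

text \<open>
  The argument \<open>c\<close> is the function \<open>d \<mapsto> c(d)\<close> in the bound on the number of simplices met
  by a hyperplane.
\<close>

definition good_partition ::
  "(nat \<Rightarrow> real) \<Rightarrow> (real ^ 'n) set \<Rightarrow> nat
     \<Rightarrow> (nat \<Rightarrow> (real ^ 'n) set \<times> (real ^ 'n) set) \<Rightarrow> bool" where
  "good_partition c P r \<Q> \<longleftrightarrow>
     simplicial_partition P r \<Q> \<and>
     (\<forall>H. hyperplane H \<longrightarrow>
        real (card {j\<in>{1..r}. snd (\<Q> j) \<inter> H \<noteq> {}})
          \<le> c CARD('n) * real r powr (1 - 1 / real CARD('n))) \<and>
     general_position (\<Union>\<Delta>\<in>simplices_of r \<Q>. {v. v extreme_point_of \<Delta>})"

text \<open>
  A family of \<open>d + 1\<close> sets is indexed by \<open>1, ..., d + 1\<close>, so equal sets at different indices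
  count as different members.
\<close>

definition separated_family :: "(nat \<Rightarrow> (real ^ 'n) set) \<Rightarrow> bool" where
  "separated_family K \<longleftrightarrow>
     (\<forall>k. 2 \<le> k \<and> k \<le> CARD('n) + 1 \<longrightarrow>
        \<not> (\<exists>J F. J \<subseteq> {1..CARD('n) + 1} \<and> card J = k \<and>
              affine F \<and> aff_dim F = int k - 2 \<and> (\<forall>i\<in>J. K i \<inter> F \<noteq> {})))"

definition crossed_family :: "(nat \<Rightarrow> (real ^ 'n) set) \<Rightarrow> bool" where
  "crossed_family K \<longleftrightarrow> \<not> separated_family K"

end

theory Submission imports Defs begin

text \<open>
  A crossed tuple of simplices is met by a single hyperplane. Move that hyperplane, keeping it in
  contact with all simplices, until it passes through as many vertices as possible. It is then
  forced by at most \<open>d\<close> vertices, which belong to at most \<open>d\<close> of the \<open>d + 1\<close> simplices. Hence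
  a crossed tuple is described by \<open>d\<close> of its simplices, a bounded choice of vertices among them, and
  a last simplex met by a hyperplane depending only on these vertices; there are
  \<open>O(r^d)\<close>, \<open>O(1)\<close> and \<open>O(r^(1 - 1/d))\<close> choices, respectively.
\<close>

section \<open>Tight constraints in polyhedral cones\<close>

text \<open>This is the ratio test of linear programming. A constraint with
  \<open>g \<bullet> z < 0\<close> reaches zero at time
  \<open>(g \<bullet> y) / (- (g \<bullet> z))\<close>. Stopping at the least such time keeps all of
  these nonnegative, and the remaining constraints do not decrease along \<open>z\<close>.\<close>

lemma nonneg_until_tight:
  fixes y z :: "'a::euclidean_space"
  assumes fin: "finite G" and g0: "g0 \<in> G" "g0 \<bullet> z < 0" and nn: "\<And>g. g \<in> G \<Longrightarrow> 0 \<le> g \<bullet> y"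
  shows "\<exists>t. (\<forall>g\<in>G. 0 \<le> g \<bullet> (y + t *\<^sub>R z)) \<and> (\<exists>g\<in>G. g \<bullet> z < 0 \<and> g \<bullet> (y + t *\<^sub>R z) = 0)"
proof -
  define N where "N = {g \<in> G. g \<bullet> z < 0}"
  define q where "q g = (g \<bullet> y) / (- (g \<bullet> z))" for g
  have N: "finite N" "N \<noteq> {}" using fin g0 by (auto simp: N_def)
  define t where "t = Min (q ` N)"
  have "t \<in> q ` N" unfolding t_def using N by (intro Min_in) auto
  then obtain g1 where g1: "g1 \<in> N" "t = q g1" by auto
  have tle: "t \<le> q g" if "g \<in> N" for g
    using N that by (auto simp: t_def)
  have t0: "0 \<le> t" using g1 nn[of g1] by (auto simp: q_def N_def intro!: divide_nonneg_neg)
  have "0 \<le> g \<bullet> (y + t *\<^sub>R z)" if g: "g \<in> G" for g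
  proof (cases "g \<bullet> z < 0")
    case True
    with g tle[of g] have "t \<le> (g \<bullet> y) / (- (g \<bullet> z))" by (auto simp: N_def q_def)
    then have "t * (- (g \<bullet> z)) \<le> g \<bullet> y"
      using True by (subst (asm) pos_le_divide_eq) auto
    then show ?thesis by (simp add: inner_add_right)
  next
    case False
    then have "0 \<le> t * (g \<bullet> z)" using t0 by simp
    with nn[OF g] show ?thesis by (simp add: inner_add_right)
  qed
  moreover have "g1 \<bullet> (y + t *\<^sub>R z) = 0"
    using g1 by (auto simp: N_def q_def inner_add_right field_simps)
  ultimately show ?thesis using g1(1) by (auto simp: N_def)
qed

text \<open>
  In the conclusion one cannot restrict to \<open>0 \<le> g \<bullet> z\<close>, as \<open>z\<close> may be a negative multiple of
  the extreme ray determined by \<open>B\<close>.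
\<close>

lemma cone_point_determined_by_tight_constraints:
  fixes G :: "'a::euclidean_space set"
  assumes fin: "finite G" and y0: "y0 \<noteq> 0" "\<And>g. g \<in> G \<Longrightarrow> 0 \<le> g \<bullet> y0"
  obtains B where "B \<subseteq> G" "card B < DIM('a)"
    "\<And>z. (\<And>g. g \<in> B \<Longrightarrow> g \<bullet> z = 0) \<Longrightarrow> (\<forall>g\<in>G. 0 \<le> g \<bullet> z) \<or> (\<forall>g\<in>G. g \<bullet> z \<le> 0)"
proof -
  \<comment> \<open>\<open>A y\<close> collects the constraints tight at \<open>y\<close>, and
    \<open>Q\<close> describes the cone without the origin. A point of \<open>Q\<close> with the
    most tight constraints plays the part of an extreme ray, also when the cone contains
    lines.\<close>
  define A where "A y = {g \<in> G. g \<bullet> y = 0}" for y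
  define Q where "Q y \<longleftrightarrow> y \<noteq> 0 \<and> (\<forall>g\<in>G. 0 \<le> g \<bullet> y)" for y
  have "Q y0" using y0 by (auto simp: Q_def)
  moreover have "\<forall>y. Q y \<longrightarrow> card (A y) < Suc (card G)"
    using fin by (auto simp: A_def less_Suc_eq_le intro!: card_mono)
  ultimately obtain y where y: "Q y" "\<And>y'. Q y' \<Longrightarrow> card (A y') \<le> card (A y)"
    using ex_has_greatest_nat[of Q y0 "\<lambda>y. card (A y)" "Suc (card G)"] by (metis less_imp_le)
  have yn: "y \<noteq> 0" "\<And>g. g \<in> G \<Longrightarrow> 0 \<le> g \<bullet> y" using y(1) by (auto simp: Q_def)
  have finA: "finite (A y)" using fin by (simp add: A_def)
  \<comment> \<open>Moving along such a \<open>z\<close> until a new constraint becomes tight would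
    keep all of \<open>A y\<close> tight and so contradict maximality. That \<open>z\<close> is not
    a multiple of \<open>y\<close> prevents the moved point from being the origin.\<close>
  have no_neg: False
    if z: "z \<notin> span {y}" "\<And>g. g \<in> A y \<Longrightarrow> g \<bullet> z = 0" and g: "g \<in> G" "g \<bullet> z < 0" for z g
  proof -
    obtain t g1 where t: "\<forall>g\<in>G. 0 \<le> g \<bullet> (y + t *\<^sub>R z)"
      and g1: "g1 \<in> G" "g1 \<bullet> z < 0" "g1 \<bullet> (y + t *\<^sub>R z) = 0"
      using nonneg_until_tight[OF fin g yn(2)] by blast
    have "y + t *\<^sub>R z \<noteq> 0"
    proof
      assume *: "y + t *\<^sub>R z = 0"
      then have "t \<noteq> 0" using yn(1) by auto
      moreover have "t *\<^sub>R z = - y" using * by (simp add: eq_neg_iff_add_eq_0 add.commute)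
      ultimately have "z = (- inverse t) *\<^sub>R y"
        by (metis scaleR_minus_left scaleR_minus_right scaleR_scaleR left_inverse scaleR_one)
      then have "z \<in> span {y}" by (metis span_base span_mul singletonI)
      then show False using z(1) by simp
    qed
    then have "card (A (y + t *\<^sub>R z)) \<le> card (A y)" using t y(2) by (auto simp: Q_def)
    moreover have "A y \<subset> A (y + t *\<^sub>R z)"
    proof -
      have "A y \<subseteq> A (y + t *\<^sub>R z)" using z(2) by (auto simp: A_def inner_add_right)
      moreover have "g1 \<in> A (y + t *\<^sub>R z)" using g1 by (auto simp: A_def)
      moreover have "g1 \<notin> A y" using g1(2) z(2) by fastforce
      ultimately show ?thesis by auto
    qed
    then have "card (A y) < card (A (y + t *\<^sub>R z))"
      using fin by (intro psubset_card_mono) (auto simp: A_def)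
    ultimately show False by simp
  qed
  \<comment> \<open>With both signs of \<open>z\<close> excluded, a vector orthogonal to
    \<open>A y\<close> is either a multiple of \<open>y\<close> or orthogonal to all of
    \<open>G\<close>. These two cases give the final alternative.\<close>
  have zero: "g \<bullet> z = 0"
    if "z \<notin> span {y}" "\<And>g. g \<in> A y \<Longrightarrow> g \<bullet> z = 0" "g \<in> G" for z g
    using no_neg[of z g] no_neg[of "-z" g] that
    by (metis inner_minus_right linorder_neqE_linordered_idom neg_less_0_iff_less neg_equal_0_iff_equal
        span_neg add.inverse_inverse)
  \<comment> \<open>A basis of the span of the tight constraints imposes the same equations as all
    of \<open>A y\<close>. The nonzero vector \<open>y\<close> is orthogonal to it, so one dimension
    is left over and \<open>card B\<close> is strictly below the dimension.\<close>
  obtain B where B: "B \<subseteq> A y" "independent B" "A y \<subseteq> span B"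
    by (rule maximal_independent_subset)
  have BA: "g \<bullet> z = 0" if "\<And>g. g \<in> B \<Longrightarrow> g \<bullet> z = 0" "g \<in> A y" for g z
    using orthogonal_to_span[of g B z] that B(3) by (auto simp: orthogonal_def inner_commute)
  have "y \<notin> span B"
  proof
    assume "y \<in> span B"
    then have "y \<bullet> y = 0"
      using orthogonal_to_span[of y B y] B(1) by (auto simp: orthogonal_def inner_commute A_def)
    then show False using yn by simp
  qed
  then have ind: "independent (insert y B)" "y \<notin> B"
    using B(2) by (auto simp: independent_insert span_base)
  have "card (insert y B) \<le> DIM('a)" using independent_bound[OF ind(1)] by simp
  then have "card B < DIM('a)" using ind finite_subset[OF B(1) finA] by simp
  moreover have "(\<forall>g\<in>G. 0 \<le> g \<bullet> z) \<or> (\<forall>g\<in>G. g \<bullet> z \<le> 0)"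
    if "\<And>g. g \<in> B \<Longrightarrow> g \<bullet> z = 0" for z
  proof (cases "z \<in> span {y}")
    case True
    then obtain k where "z = k *\<^sub>R y" by (auto simp: span_singleton)
    then show ?thesis using yn(2)
      by (cases "0 \<le> k") (auto simp: mult_nonneg_nonneg mult_nonpos_nonneg)
  next
    case False
    have "g \<bullet> z = 0" if "g \<in> G" for g
      by (rule zero[OF False BA that]) (use \<open>\<And>g. g \<in> B \<Longrightarrow> g \<bullet> z = 0\<close> in auto)
    then show ?thesis by simp
  qed
  moreover have "B \<subseteq> G" using B(1) by (auto simp: A_def)
  ultimately show ?thesis using that by blast
qed

section \<open>Hyperplanes meeting all members of a family\<close>

lemma aff_dim_union_finite_le:
  assumes "finite X"
  shows "aff_dim (F \<union> X) \<le> aff_dim F + int (card X)"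
  using assms
proof (induction X)
  case (insert x X)
  then show ?case by (simp add: aff_dim_insert)
qed simp

text \<open>A flat of dimension \<open>k - 2\<close> meeting \<open>k\<close> members, enlarged by
  one point from each of the other \<open>d + 1 - k\<close> members, has affine dimension at most
  \<open>d - 1\<close> and therefore lies in a hyperplane.\<close>

lemma crossed_family_hyperplane:
  fixes K :: "nat \<Rightarrow> (real ^ 'n) set"
  assumes "crossed_family K" and ne: "\<And>i. i \<in> {1..CARD('n) + 1} \<Longrightarrow> K i \<noteq> {}"
  obtains H where "hyperplane H" "\<And>i. i \<in> {1..CARD('n) + 1} \<Longrightarrow> K i \<inter> H \<noteq> {}"
proof -
  let ?I = "{1..CARD('n) + 1}"
  obtain J F where J: "J \<subseteq> ?I" and F: "aff_dim F = int (card J) - 2" "\<forall>i\<in>J. K i \<inter> F \<noteq> {}"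
    using assms(1) unfolding crossed_family_def separated_family_def by blast
  define x where "x i = (SOME y. y \<in> K i)" for i
  have x: "x i \<in> K i" if "i \<in> ?I" for i
    unfolding x_def using ne[OF that] by (simp add: some_in_eq)
  define X where "X = x ` (?I - J)"
  have "card X \<le> card (?I - J)" unfolding X_def by (intro card_image_le) auto
  also have "card (?I - J) = CARD('n) + 1 - card J"
    using J by (subst card_Diff_subset) (auto intro: finite_subset)
  finally have "int (card X) \<le> int CARD('n) + 1 - int (card J)"
    using card_mono[OF _ J] by simp
  moreover have "aff_dim (F \<union> X) \<le> aff_dim F + int (card X)"
    by (intro aff_dim_union_finite_le) (simp add: X_def)
  ultimately have "aff_dim (F \<union> X) < DIM(real ^ 'n)" using F(1) by simp
  then obtain a b where ab: "a \<noteq> 0" "F \<union> X \<subseteq> {y. a \<bullet> y = b}"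
    using aff_lowdim_subset_hyperplane by blast
  show ?thesis
  proof
    show "hyperplane {y. a \<bullet> y = b}" using ab(1) by (auto simp: hyperplane_def)
    show "K i \<inter> {y. a \<bullet> y = b} \<noteq> {}" if "i \<in> ?I" for i
    proof (cases "i \<in> J")
      case True
      then show ?thesis using F(2) ab(2) by blast
    next
      case False
      then have "x i \<in> X" using that by (simp add: X_def)
      then show ?thesis using x[OF that] ab(2) by blast
    qed
  qed
qed

text \<open>If all of \<open>V\<close> were strictly on one side of the level set through
  \<open>x\<close>, that open half-space, being convex, would contain the hull and hence
  \<open>x\<close>. This translates meeting a hyperplane into linear inequalities on two
  vertices.\<close>

lemma convex_hull_inner_bounds:
  fixes a :: "'a::euclidean_space"
  assumes x: "x \<in> convex hull V"
  obtains v w where "v \<in> V" "w \<in> V" "a \<bullet> v \<le> a \<bullet> x" "a \<bullet> x \<le> a \<bullet> w"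
proof -
  have "\<exists>v\<in>V. a \<bullet> v \<le> a \<bullet> x"
  proof (rule ccontr)
    assume "\<not> ?thesis"
    then have "V \<subseteq> {y. a \<bullet> y > a \<bullet> x}" by auto
    then have "convex hull V \<subseteq> {y. a \<bullet> y > a \<bullet> x}"
      by (intro hull_minimal) (auto simp: convex_halfspace_gt)
    then show False using x by auto
  qed
  moreover have "\<exists>w\<in>V. a \<bullet> x \<le> a \<bullet> w"
  proof (rule ccontr)
    assume "\<not> ?thesis"
    then have "V \<subseteq> {y. a \<bullet> y < a \<bullet> x}" by auto
    then have "convex hull V \<subseteq> {y. a \<bullet> y < a \<bullet> x}"
      by (intro hull_minimal) (auto simp: convex_halfspace_lt)
    then show False using x by auto
  qed
  ultimately show ?thesis using that by blast
qed

lemma convex_meets_hyperplane_between: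
  fixes a :: "'a::euclidean_space"
  assumes "convex K" "v \<in> K" "w \<in> K" "a \<bullet> v \<le> b" "b \<le> a \<bullet> w"
  shows "K \<inter> {x. a \<bullet> x = b} \<noteq> {}"
proof -
  obtain z where "z \<in> K" "a \<bullet> z = b"
    using connected_ivt_hyperplane[OF convex_connected[OF assms(1)] assms(2-5)] by blast
  then show ?thesis by auto
qed

text \<open>For each \<open>i\<close>, one vertex on either side of \<open>H\<close> is fixed. The
  hyperplanes leaving these vertices on their sides form a polyhedral cone in dimension
  \<open>d + 1\<close>, where at most \<open>d\<close> tight constraints decide all others up to a
  common sign. A tight constraint means passing through a vertex, and a change of sign merely swaps
  the two sides.\<close>

lemma transversal_hyperplane_determined_by_vertices:
  fixes V :: "'i \<Rightarrow> (real ^ 'n) set"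
  assumes finI: "finite I"
    and H: "hyperplane H" "\<And>i. i \<in> I \<Longrightarrow> convex hull (V i) \<inter> H \<noteq> {}"
  obtains S J where "J \<subseteq> I" "card J \<le> CARD('n)" "S \<subseteq> (\<Union>j\<in>J. V j)" "card S \<le> CARD('n)"
    "\<And>H' i. \<lbrakk>hyperplane H'; S \<subseteq> H'; i \<in> I\<rbrakk> \<Longrightarrow> convex hull (V i) \<inter> H' \<noteq> {}"
proof -
  obtain a b where ab: "a \<noteq> 0" "H = {x. a \<bullet> x = b}" using H(1) by (auto simp: hyperplane_def)
  have "\<exists>v w. v \<in> V i \<and> w \<in> V i \<and> a \<bullet> v \<le> b \<and> b \<le> a \<bullet> w" if "i \<in> I" for i
  proof -
    obtain x where "x \<in> convex hull (V i)" "a \<bullet> x = b" using H(2)[OF \<open>i \<in> I\<close>] ab by auto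
    then show ?thesis using convex_hull_inner_bounds[of x "V i" a] by metis
  qed
  then obtain v w where vw: "\<And>i. i \<in> I \<Longrightarrow> v i \<in> V i \<and> w i \<in> V i \<and> a \<bullet> v i \<le> b \<and> b \<le> a \<bullet> w i"
    by metis
  \<comment> \<open>The hyperplane \<open>a \<bullet> x = b\<close> is encoded as the vector \<open>(a, b)\<close>.\<close>
  define G where "G = (\<lambda>i. (w i, -1::real)) ` I \<union> (\<lambda>i. (- v i, 1)) ` I"
  have finG: "finite G" using finI by (simp add: G_def)
  have nz: "(a, b) \<noteq> 0" using ab by (auto simp: zero_prod_def)
  have nn: "0 \<le> g \<bullet> (a, b)" if "g \<in> G" for g
    using that vw by (auto simp: G_def inner_commute)
  obtain B where B: "B \<subseteq> G" "card B < DIM((real ^ 'n) \<times> real)"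
    "\<And>z. (\<And>g. g \<in> B \<Longrightarrow> g \<bullet> z = 0) \<Longrightarrow> (\<forall>g\<in>G. 0 \<le> g \<bullet> z) \<or> (\<forall>g\<in>G. g \<bullet> z \<le> 0)"
    using cone_point_determined_by_tight_constraints[OF finG nz nn] by blast
  have cB: "card B \<le> CARD('n)" "finite B" using B(1,2) finG by (auto intro: finite_subset)
  have "\<exists>i p. i \<in> I \<and> p \<in> V i \<and> (g = (p, -1) \<or> g = (- p, 1))" if "g \<in> B" for g
    using that B(1) vw by (fastforce simp: G_def)
  \<comment> \<open>\<open>pt g\<close> is the vertex behind the constraint \<open>g\<close>, and
    \<open>ix g\<close> is one index whose vertex set contains it. With one index per constraint,
    both images have at most \<open>d\<close> elements.\<close>
  then obtain ix pt where ip: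
    "\<And>g. g \<in> B \<Longrightarrow> ix g \<in> I \<and> pt g \<in> V (ix g) \<and> (g = (pt g, -1) \<or> g = (- pt g, 1))"
    by metis
  show ?thesis
  proof
    show "ix ` B \<subseteq> I" "pt ` B \<subseteq> (\<Union>j\<in>ix ` B. V j)" using ip by auto
    show "card (ix ` B) \<le> CARD('n)" "card (pt ` B) \<le> CARD('n)"
      using cB card_image_le le_trans by blast+
    fix H' i assume H': "hyperplane H'" "pt ` B \<subseteq> H'" and i: "i \<in> I"
    obtain a' b' where ab': "H' = {x. a' \<bullet> x = b'}" using H'(1) by (auto simp: hyperplane_def)
    have "g \<bullet> (a', b') = 0" if "g \<in> B" for g
    proof -
      have "pt g \<bullet> a' = b'" using H'(2) that ab' by (auto simp: inner_commute)
      then have "(pt g, -1) \<bullet> (a', b') = 0" "(- pt g, 1) \<bullet> (a', b') = 0" by simp_all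
      then show ?thesis using ip[OF that] by metis
    qed
    \<comment> \<open>In the second case all inequalities are reversed, so \<open>v i\<close> and
      \<open>w i\<close> exchange roles; either way \<open>H'\<close> separates them weakly and
      meets the hull.\<close>
    then consider "\<forall>g\<in>G. 0 \<le> g \<bullet> (a', b')" | "\<forall>g\<in>G. g \<bullet> (a', b') \<le> 0"
      using B(3) by blast
    then show "convex hull (V i) \<inter> H' \<noteq> {}"
    proof cases
      case 1
      with i have "a' \<bullet> v i \<le> b'" "b' \<le> a' \<bullet> w i" by (simp_all add: G_def ball_Un inner_commute)
      then show ?thesis unfolding ab' using vw[OF i]
        by (intro convex_meets_hyperplane_between[of _ "v i" "w i"]) (auto intro: hull_inc)
    next
      case 2
      with i have "a' \<bullet> w i \<le> b'" "b' \<le> a' \<bullet> v i" by (simp_all add: G_def ball_Un inner_commute)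
      then show ?thesis unfolding ab' using vw[OF i]
        by (intro convex_meets_hyperplane_between[of _ "w i" "v i"]) (auto intro: hull_inc)
    qed
  qed
qed

section \<open>Vertices of simplices and counting in products\<close>

lemma hyperplane_through_points:
  fixes S :: "(real ^ 'n) set"
  assumes "finite S" "card S \<le> CARD('n)"
  obtains H where "hyperplane H" "S \<subseteq> H"
proof -
  have "aff_dim S < DIM(real ^ 'n)" using aff_dim_le_card[OF assms(1)] assms(2) by simp
  then obtain a b where "a \<noteq> 0" "S \<subseteq> {y. a \<bullet> y = b}"
    using aff_lowdim_subset_hyperplane by blast
  then show ?thesis using that by (auto simp: hyperplane_def)
qed

lemma simplex_extreme_points:
  fixes \<Delta> :: "(real ^ 'n) set"
  assumes "int CARD('n) simplex \<Delta>"
  shows "finite {v. v extreme_point_of \<Delta>}" "card {v. v extreme_point_of \<Delta>} \<le> CARD('n) + 1"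
    "convex hull {v. v extreme_point_of \<Delta>} = \<Delta>" "\<Delta> \<noteq> {}"
proof -
  obtain C where C: "\<not> affine_dependent C" "int (card C) = int CARD('n) + 1" "\<Delta> = convex hull C"
    using assms by (auto simp: simplex_def)
  have fC: "finite C" using C(1) aff_independent_finite by blast
  have "{v. v extreme_point_of \<Delta>} = C"
    using extreme_point_of_convex_hull_affine_independent[OF C(1)] C(3) by auto
  then show "finite {v. v extreme_point_of \<Delta>}" "card {v. v extreme_point_of \<Delta>} \<le> CARD('n) + 1"
    "convex hull {v. v extreme_point_of \<Delta>} = \<Delta>" "\<Delta> \<noteq> {}"
    using C fC by auto
qed

text \<open>A tuple is determined by its coordinate \<open>i\<close> and its restriction to the
  other indices. There are at most \<open>r ^ (card I - 1)\<close> restrictions, and each admits at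
  most \<open>M\<close> values of the coordinate \<open>i\<close>.\<close>

lemma card_PiE_fibre_bound:
  fixes M :: real
  assumes "finite I" "i \<in> I" "\<And>j. j \<in> I \<Longrightarrow> finite (A j) \<and> card (A j) \<le> r"
    and M: "0 \<le> M" "\<And>U. U \<in> (\<Pi>\<^sub>E j\<in>I - {i}. A j) \<Longrightarrow> real (card {x \<in> A i. R U x}) \<le> M"
  shows "real (card {T \<in> (\<Pi>\<^sub>E j\<in>I. A j). R (restrict T (I - {i})) (T i)}) \<le> real r ^ (card I - 1) * M"
proof -
  let ?U = "\<Pi>\<^sub>E j\<in>I - {i}. A j"
  let ?X = "{T \<in> (\<Pi>\<^sub>E j\<in>I. A j). R (restrict T (I - {i})) (T i)}"
  let ?f = "\<lambda>T. (restrict T (I - {i}), T i)"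
  have finU: "finite ?U" using assms(1,3) by (intro finite_PiE) auto
  have inj: "inj_on ?f ?X"
  proof (rule inj_onI)
    fix T T' assume T: "T \<in> ?X" "T' \<in> ?X" "?f T = ?f T'"
    have "T j = T' j" if "j \<in> I" for j
    proof (cases "j = i")
      case True then show ?thesis using T(3) by simp
    next
      case False then show ?thesis using T(3) that
        by (metis Diff_iff fst_conv restrict_apply' singletonD)
    qed
    then show "T = T'" using T(1,2) by (auto intro: PiE_ext)
  qed
  have "?f ` ?X \<subseteq> (SIGMA U:?U. {x \<in> A i. R U x})"
  proof (clarify, intro SigmaI CollectI conjI)
    fix T assume T: "T \<in> (\<Pi>\<^sub>E j\<in>I. A j)" "R (restrict T (I - {i})) (T i)"
    show "restrict T (I - {i}) \<in> ?U" using T(1) by (intro restrict_PiE_iff[THEN iffD2]) auto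
    show "T i \<in> A i" using T(1) assms(2) by auto
  qed
  moreover have "finite (SIGMA U:?U. {x \<in> A i. R U x})" using finU assms(2,3) by (intro finite_SigmaI) auto
  ultimately have "card ?X \<le> card (SIGMA U:?U. {x \<in> A i. R U x})"
    by (rule card_inj_on_le[OF inj])
  also have "\<dots> = (\<Sum>U\<in>?U. card {x \<in> A i. R U x})" using finU assms(2,3) by (intro card_SigmaI) auto
  finally have "real (card ?X) \<le> (\<Sum>U\<in>?U. real (card {x \<in> A i. R U x}))"
    by (simp only: of_nat_sum[symmetric] of_nat_le_iff)
  also have "\<dots> \<le> real (card ?U) * M" using M(2) by (intro sum_bounded_above) auto
  also have "\<dots> \<le> real r ^ (card I - 1) * M"
  proof -
    have "card ?U = (\<Prod>j\<in>I - {i}. card (A j))" using assms(1) by (intro card_PiE) auto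
    also have "\<dots> \<le> (\<Prod>j\<in>I - {i}. r)" using assms(3) by (intro prod_mono) auto
    also have "\<dots> = r ^ (card I - 1)" using assms(1,2) by simp
    finally show ?thesis using M(1) by (intro mult_right_mono) (auto simp flip: of_nat_power)
  qed
  finally show ?thesis .
qed

text \<open>The given bound counts indices. Several indices may carry the same simplex, so counting
  simplices gives at most that number.\<close>

lemma card_simplices_meeting_hyperplane:
  assumes "good_partition c (P :: (real ^ 'n) set) r \<Q>" "hyperplane H"
  shows "real (card {\<Delta> \<in> simplices_of r \<Q>. \<Delta> \<inter> H \<noteq> {}})
    \<le> c CARD('n) * real r powr (1 - 1 / real CARD('n))"
proof -
  have "{\<Delta> \<in> simplices_of r \<Q>. \<Delta> \<inter> H \<noteq> {}} = (\<lambda>j. snd (\<Q> j)) ` {j\<in>{1..r}. snd (\<Q> j) \<inter> H \<noteq> {}}"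
    by (auto simp: simplices_of_def)
  then have "card {\<Delta> \<in> simplices_of r \<Q>. \<Delta> \<inter> H \<noteq> {}} \<le> card {j\<in>{1..r}. snd (\<Q> j) \<inter> H \<noteq> {}}"
    by (simp add: card_image_le)
  then show ?thesis using assms by (force simp: good_partition_def)
qed

section \<open>Counting crossed tuples of simplices\<close>

theorem theorem5p2:
  fixes c :: "nat \<Rightarrow> real"
  assumes "CARD('n::finite) \<ge> 2"
  shows "\<exists>C>0. \<forall>(P :: nat \<Rightarrow> (real ^ 'n) set) (r :: nat)
      (\<Q> :: nat \<Rightarrow> nat \<Rightarrow> (real ^ 'n) set \<times> (real ^ 'n) set).
    (\<forall>i\<in>{1..CARD('n) + 1}. finite (P i) \<and> general_position (P i)) \<longrightarrow>
    0 < r \<longrightarrow>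
    r \<le> (MIN i\<in>{1..CARD('n) + 1}. card (P i)) \<longrightarrow>
    (\<forall>i\<in>{1..CARD('n) + 1}. good_partition c (P i) r (\<Q> i)) \<longrightarrow>
    real (card {T \<in> (\<Pi>\<^sub>E i\<in>{1..CARD('n) + 1}. simplices_of r (\<Q> i)). crossed_family T})
      \<le> C * real r powr (real CARD('n) + 1 - 1 / real CARD('n))"
proof -
  define d where "d = CARD('n)"
  define I where "I = {1..d + 1}"
  \<comment> \<open>There are \<open>d + 1\<close> choices of the last index, and
    \<open>2 ^ (d * (d + 1))\<close> bounds the number of vertex sets taken from \<open>d\<close>
    simplices with \<open>d + 1\<close> vertices each. The absolute value allows for a negative
    \<open>c d\<close>, and the summand 1 makes \<open>C\<close> positive.\<close>
  define C where "C = real (d + 1) * (2 ^ (d * (d + 1)) * \<bar>c d\<bar>) + 1"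
  define ext :: "(real ^ 'n) set \<Rightarrow> (real ^ 'n) set" where "ext \<Delta> = {v. v extreme_point_of \<Delta>}" for \<Delta>
  \<comment> \<open>The hyperplane is chosen from \<open>S\<close> alone, so it does not depend on
    the simplex that is counted last.\<close>
  define h :: "(real ^ 'n) set \<Rightarrow> (real ^ 'n) set" where "h S = (SOME H. hyperplane H \<and> S \<subseteq> H)" for S
  have h: "hyperplane (h S)" "S \<subseteq> h S" if "finite S" "card S \<le> d" for S
  proof -
    have "\<exists>H. hyperplane H \<and> S \<subseteq> H"
      using hyperplane_through_points[OF that[unfolded d_def]] by blast
    then show "hyperplane (h S)" "S \<subseteq> h S" unfolding h_def by (metis (mono_tags, lifting) someI_ex)+
  qed
  have "real (card {T \<in> (\<Pi>\<^sub>E i\<in>I. simplices_of r (\<Q> i)). crossed_family T})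
      \<le> C * real r powr (real d + 1 - 1 / real d)"
    if r: "0 < r" and good: "\<forall>i\<in>I. good_partition c (P i) r (\<Q> i)"
    for P :: "nat \<Rightarrow> (real ^ 'n) set" and r
      and \<Q> :: "nat \<Rightarrow> nat \<Rightarrow> (real ^ 'n) set \<times> (real ^ 'n) set"
  proof -
    define A where "A i = simplices_of r (\<Q> i)" for i
    define m where "m = \<bar>c d\<bar> * real r powr (1 - 1 / real d)"
    \<comment> \<open>The last simplex meets one of the chosen hyperplanes through at most
      \<open>d\<close> vertices of the simplices \<open>U j\<close> with
      \<open>j \<in> J\<close>.\<close>
    define R where "R J U \<Delta> \<longleftrightarrow> (\<exists>S \<in> Pow (\<Union>j\<in>J. ext (U j)). card S \<le> d \<and> \<Delta> \<inter> h S \<noteq> {})"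
      for J :: "nat set" and U :: "nat \<Rightarrow> (real ^ 'n) set" and \<Delta>
    have simplex: "int CARD('n) simplex \<Delta>" if "\<Delta> \<in> A i" "i \<in> I" for \<Delta> i
      using good that by (auto simp: A_def simplices_of_def good_partition_def simplicial_partition_def)
    have finA: "finite (A i) \<and> card (A i) \<le> r" for i
      using card_image_le[of "{1..r}" "\<lambda>j. snd (\<Q> i j)"] by (simp add: A_def simplices_of_def)
    have m0: "0 \<le> m" by (simp add: m_def)
    have meet: "real (card {\<Delta> \<in> A i. \<Delta> \<inter> H \<noteq> {}}) \<le> m" if "i \<in> I" "hyperplane H" for i H
    proof -
      have "real (card {\<Delta> \<in> A i. \<Delta> \<inter> H \<noteq> {}}) \<le> c d * real r powr (1 - 1 / real d)"
        using card_simplices_meeting_hyperplane[of c "P i" r "\<Q> i" H] good that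
        by (simp add: A_def d_def)
      also have "\<dots> \<le> m" unfolding m_def by (intro mult_right_mono) auto
      finally show ?thesis .
    qed
    have fibre: "real (card {\<Delta> \<in> A i. R (I - {i}) U \<Delta>}) \<le> 2 ^ (d * (d + 1)) * m"
      if i: "i \<in> I" and U: "U \<in> (\<Pi>\<^sub>E j\<in>I - {i}. A j)" for i U
    proof -
      let ?W = "\<Union>j\<in>I - {i}. ext (U j)"
      let ?Z = "{S \<in> Pow ?W. card S \<le> d}"
      have sU: "int CARD('n) simplex U j" if "j \<in> I - {i}" for j using U simplex that by auto
      have finW: "finite ?W" using simplex_extreme_points(1)[OF sU] by (auto simp: I_def ext_def)
      have "card ?W \<le> (\<Sum>j\<in>I - {i}. card (ext (U j)))" by (intro card_UN_le) (auto simp: I_def)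
      also have "\<dots> \<le> (\<Sum>j\<in>I - {i}. d + 1)"
        using simplex_extreme_points(2)[OF sU] by (intro sum_mono) (auto simp: ext_def d_def)
      also have "\<dots> = d * (d + 1)" using i by (simp add: I_def)
      finally have "card ?W \<le> d * (d + 1)" .
      then have "card (Pow ?W) \<le> 2 ^ (d * (d + 1))"
        using finW by (simp add: card_Pow power_increasing del: mult_Suc_right)
      moreover have "card ?Z \<le> card (Pow ?W)" using finW by (intro card_mono) auto
      ultimately have cZ: "card ?Z \<le> 2 ^ (d * (d + 1))" by linarith
      have finZ: "finite ?Z" using finW by auto
      \<comment> \<open>The fibre is a union over the boundedly many sets \<open>S\<close>, and each
        \<open>h S\<close> meets at most \<open>m\<close> simplices of \<open>A i\<close>.\<close>
      have "{\<Delta> \<in> A i. R (I - {i}) U \<Delta>} = (\<Union>S\<in>?Z. {\<Delta> \<in> A i. \<Delta> \<inter> h S \<noteq> {}})"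
        by (auto simp: R_def)
      then have "card {\<Delta> \<in> A i. R (I - {i}) U \<Delta>} \<le> (\<Sum>S\<in>?Z. card {\<Delta> \<in> A i. \<Delta> \<inter> h S \<noteq> {}})"
        using card_UN_le[OF finZ] by simp
      then have "real (card {\<Delta> \<in> A i. R (I - {i}) U \<Delta>}) \<le> (\<Sum>S\<in>?Z. real (card {\<Delta> \<in> A i. \<Delta> \<inter> h S \<noteq> {}}))"
        by (simp only: of_nat_sum[symmetric] of_nat_le_iff)
      also have "\<dots> \<le> real (card ?Z) * m"
      proof (intro sum_bounded_above)
        fix S assume "S \<in> ?Z"
        then show "real (card {\<Delta> \<in> A i. \<Delta> \<inter> h S \<noteq> {}}) \<le> m"
          using finW by (intro meet i h(1)) (auto intro: finite_subset)
      qed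
      also have "\<dots> \<le> 2 ^ (d * (d + 1)) * m"
      proof (intro mult_right_mono m0)
        show "real (card ?Z) \<le> 2 ^ (d * (d + 1))" using of_nat_mono[OF cZ, where ?'a = real] by simp
      qed
      finally show ?thesis .
    qed
    let ?X = "\<lambda>i. {T \<in> (\<Pi>\<^sub>E j\<in>I. A j). R (I - {i}) (restrict T (I - {i})) (T i)}"
    have finX: "finite (\<Pi>\<^sub>E j\<in>I. A j)" using finA by (intro finite_PiE) (auto simp: I_def)
    have "{T \<in> (\<Pi>\<^sub>E i\<in>I. A i). crossed_family T} \<subseteq> (\<Union>i\<in>I. ?X i)"
    proof
      fix T assume T: "T \<in> {T \<in> (\<Pi>\<^sub>E i\<in>I. A i). crossed_family T}"
      have sT: "int CARD('n) simplex T i" if "i \<in> I" for i using T that simplex by auto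
      note ep = simplex_extreme_points[OF sT, folded ext_def]
      obtain H where H: "hyperplane H" "\<And>i. i \<in> I \<Longrightarrow> T i \<inter> H \<noteq> {}"
        using crossed_family_hyperplane[of T] T ep(4) by (auto simp: I_def d_def)
      have "finite I" by (simp add: I_def)
      then obtain S J where J: "J \<subseteq> I" "card J \<le> d" and S: "S \<subseteq> (\<Union>j\<in>J. ext (T j))" "card S \<le> d"
        and meets: "\<And>H' i. \<lbrakk>hyperplane H'; S \<subseteq> H'; i \<in> I\<rbrakk> \<Longrightarrow> convex hull (ext (T i)) \<inter> H' \<noteq> {}"
      proof (rule transversal_hyperplane_determined_by_vertices)
        show "convex hull (ext (T i)) \<inter> H \<noteq> {}" if "i \<in> I" for i
          using ep(3)[OF that] H(2)[OF that] by simp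
      qed (use H(1) in \<open>auto simp: d_def\<close>)
      \<comment> \<open>At most \<open>d\<close> of the \<open>d + 1\<close> simplices supply
        vertices, so some index \<open>i\<close> supplies none; \<open>S\<close> then survives the
        restriction of \<open>T\<close> to \<open>I - {i}\<close>.\<close>
      have "J \<noteq> I" using J(2) by (auto simp: I_def)
      then obtain i where i: "i \<in> I" "i \<notin> J" using J(1) by auto
      have "(\<Union>j\<in>J. ext (T j)) \<subseteq> (\<Union>j\<in>I - {i}. ext (restrict T (I - {i}) j))" using i J(1) by auto
      then have "S \<in> Pow (\<Union>j\<in>I - {i}. ext (restrict T (I - {i}) j))" using S(1) by simp
      moreover have "finite S"
      proof (rule finite_subset[OF S(1)], intro finite_UN_I)
        show "finite J" using J(1) by (rule finite_subset) (simp add: I_def)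
        show "finite (ext (T j))" if "j \<in> J" for j using ep(1) J(1) that by blast
      qed
      \<comment> \<open>Every hyperplane through \<open>S\<close> meets all the simplices, so the
        chosen \<open>h S\<close> in particular meets \<open>T i\<close>.\<close>
      then have "T i \<inter> h S \<noteq> {}" using meets[OF h i(1)] S(2) ep(3)[OF i(1)] by auto
      ultimately have "R (I - {i}) (restrict T (I - {i})) (T i)" using S(2) unfolding R_def
        by (intro bexI[of _ S] conjI)
      then show "T \<in> (\<Union>i\<in>I. ?X i)" using T i(1) by auto
    qed
    then have "card {T \<in> (\<Pi>\<^sub>E i\<in>I. A i). crossed_family T} \<le> card (\<Union>i\<in>I. ?X i)"
      using finX by (intro card_mono finite_UN_I) (auto simp: I_def)
    also have "\<dots> \<le> (\<Sum>i\<in>I. card (?X i))" by (intro card_UN_le) (simp add: I_def)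
    finally have "real (card {T \<in> (\<Pi>\<^sub>E i\<in>I. A i). crossed_family T}) \<le> (\<Sum>i\<in>I. real (card (?X i)))"
      by (simp only: of_nat_sum[symmetric] of_nat_le_iff)
    also have "\<dots> \<le> real (card I) * (real r ^ (card I - 1) * (2 ^ (d * (d + 1)) * m))"
    proof (intro sum_bounded_above)
      fix i assume i: "i \<in> I"
      show "real (card (?X i)) \<le> real r ^ (card I - 1) * (2 ^ (d * (d + 1)) * m)"
      proof (rule card_PiE_fibre_bound)
        show "finite I" by (simp add: I_def)
        show "0 \<le> 2 ^ (d * (d + 1)) * m" using m0 by simp
      qed (use i finA fibre[OF i] in blast)+
    qed
    \<comment> \<open>Here \<open>card I - 1\<close> is \<open>d\<close>, and \<open>C - 1\<close>
      gathers the factors independent of \<open>r\<close>; positivity of \<open>r\<close> turns the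
      natural power into \<open>powr\<close>.\<close>
    also have "\<dots> = (C - 1) * (real r powr real d * real r powr (1 - 1 / real d))"
      using r by (simp add: I_def C_def m_def powr_realpow)
    also have "\<dots> = (C - 1) * real r powr (real d + 1 - 1 / real d)"
      by (simp flip: powr_add add: algebra_simps)
    also have "\<dots> \<le> C * real r powr (real d + 1 - 1 / real d)"
      by (intro mult_right_mono) auto
    finally show ?thesis by (simp add: A_def)
  qed
  moreover have "C > 0" unfolding C_def by (intro add_nonneg_pos) auto
  ultimately show ?thesis unfolding I_def d_def by blast
qed

end
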